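(* Let the hypothesis class be $\mathcal{H}$ or $\mathcal{H}'$. For each integer $n\ge 2$ let $\mathcal{D}_n$ be the uniform distribution on $\{2, \dots, n\}$, let $m_n$ be a positive integer, and let $S_n = ((X_1, r(X_1)), \dots, (X_{m_n}, r(X_{m_n})))$ be a sample with instances $X_1, \dots, X_{m_n}$ i.i.d. from $\mathcal{D}_n$, labelled by the prime labeling function $r$. Let $h_{S_n}$ be the empirical risk minimization hypothesis based on $S_n$. If $m_n = \omega\big((\log n)^2\big)$, then $L_{\mathcal{D}_n}(h_{S_n}) \to 1/2$ in probability as $n \to \infty$. Furthermore, if $m_n = \omega\big((\log n)^3\big)$, then $L_{\mathcal{D}_n}(h_{S_n}) \to 1/2$ almost surely as $n \to \infty$.
   Context: Let $\mathcal{X} = \{n \in \mathbb{N} : n \geq 2\}$. For $d \in \mathcal{X}$ define $h_d : \mathcal{X} \to \{0,1\}$ by $h_d(x) = 0$ if $d \mid x$ and $x > d$, and $h_d(x) = 1$ otherwise. Let $\mathcal{H} = \{h_d : d \in \mathcal{X}\}$ and $\mathcal{H}' = \{h_p : p \in \mathcal{X},\ p \text{ prime}\}$. The prime labeling function is $r(x) = 1$ if $x$ is prime and $r(x) = 0$ otherwise. For positive functions, $f(n) = \omega(g(n))$ means $\lim_{n\to\infty} f(n)/g(n) = \infty$. For a sample $S = ((X_1, r(X_1)), \dots, (X_m, r(X_m)))$ put \[ D(S,d) = \frac1m \sum_{i :\, r(X_i) = 0} \mathbf{1}\{d \mid X_i\}\,\mathbf{1}\{X_i > d\}, \qquad d \in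 \mathcal{X}, \] and let $d_S$ be the smallest index $d$ maximizing $D(S,d)$ over $d \in \mathcal{X}$ (for the class $\mathcal{H}$), respectively over primes $d$ (for the class $\mathcal{H}'$). The empirical risk minimization hypothesis is $h_S := h_{d_S}$; it minimizes the empirical risk $\frac1m\sum_{i=1}^m \mathbf{1}\{h_d(X_i) \neq r(X_i)\}$ over the class. The generalization error of $h_d$ under a distribution $\mathcal{D}$ is $L_{\mathcal{D}}(h_d) = \mathbb{P}(h_d(X) \neq r(X))$ with $X \sim \mathcal{D}$; $L_{\mathcal{D}_n}(h_{S_n})$ is the random variable obtained by evaluating $d \mapsto L_{\mathcal{D}_n}(h_d)$ at $d = d_{S_n}$. The samples $S_n$ for different $n$ are defined on a common probability space, with no assumption on their joint dependence across $n$. *)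

theory Defs
  imports "HOL-Probability.Probability" "HOL-Computational_Algebra.Primes"
begin

definition instance_space :: "nat set" where
  "instance_space = {2..}"

text \<open>The classes \<open>H\<close> and \<open>H'\<close> are represented by their index sets \<open>instance_space\<close> and
  \<open>prime_indices\<close>: a class is the image of its index set under \<open>hyp\<close>.\<close>

definition prime_indices :: "nat set" where
  "prime_indices = {p \<in> instance_space. prime p}"

definition hyp :: "nat \<Rightarrow> nat \<Rightarrow> nat" where
  "hyp d x = (if d dvd x \<and> d < x then 0 else 1)"

definition prime_label :: "nat \<Rightarrow> nat" where
  "prime_label x = (if prime x then 1 else 0)"

text \<open>A sample is a list of (instance, label) pairs.\<close>

definition labelled_sample :: "nat list \<Rightarrow> (nat \<times> nat) list" where
  "labelled_sample xs = map (\<lambda>x. (x, prime_label x)) xs"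

definition empirical_risk :: "(nat \<times> nat) list \<Rightarrow> (nat \<Rightarrow> nat) \<Rightarrow> real" where
  "empirical_risk S h =
     1 / real (length S) * (\<Sum>i<length S. of_bool (h (fst (S ! i)) \<noteq> snd (S ! i)))"

definition divisor_score :: "(nat \<times> nat) list \<Rightarrow> nat \<Rightarrow> real" where
  "divisor_score S d =
     1 / real (length S) *
       (\<Sum>i | i < length S \<and> snd (S ! i) = 0.
          of_bool (d dvd fst (S ! i)) * of_bool (d < fst (S ! i)))"

definition erm_index :: "nat set \<Rightarrow> (nat \<times> nat) list \<Rightarrow> nat" where
  "erm_index I S = (LEAST d. is_arg_max (divisor_score S) (\<lambda>d. d \<in> I) d)"

definition erm_hyp :: "nat set \<Rightarrow> (nat \<times> nat) list \<Rightarrow> nat \<Rightarrow> nat" where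
  "erm_hyp I S = hyp (erm_index I S)"

definition gen_error :: "nat pmf \<Rightarrow> (nat \<Rightarrow> nat) \<Rightarrow> real" where
  "gen_error D h = measure_pmf.prob D {x. h x \<noteq> prime_label x}"

definition tendsto_in_prob :: "'a measure \<Rightarrow> (nat \<Rightarrow> 'a \<Rightarrow> real) \<Rightarrow> real \<Rightarrow> bool" where
  "tendsto_in_prob M Y c \<longleftrightarrow>
     (\<forall>\<epsilon>>0. (\<lambda>n. measure M {\<omega> \<in> space M. \<bar>Y n \<omega> - c\<bar> > \<epsilon>}) \<longlonglongrightarrow> 0)"

text \<open>The maximum in \<open>erm_index\<close> is attained, and the resulting hypothesis minimizes the
  empirical risk over the class.\<close>

lemma erm_index_is_arg_max:
  assumes "I \<noteq> {}"
  shows "is_arg_max (divisor_score S) (\<lambda>d. d \<in> I) (erm_index I S)"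
proof -
  let ?c = "\<lambda>d. card {i. i < length S \<and> snd (S ! i) = 0 \<and> d dvd fst (S ! i) \<and> d < fst (S ! i)}"
  have score: "divisor_score S d = 1 / real (length S) * real (?c d)" for d
  proof -
    let ?A = "{i. i < length S \<and> snd (S ! i) = 0}"
    let ?P = "\<lambda>i. d dvd fst (S ! i) \<and> d < fst (S ! i)"
    have "?A \<subseteq> {..<length S}"
      by (simp add: subset_eq)
    then have fin: "finite ?A"
      by (rule finite_subset) (rule finite_lessThan)
    have "(\<Sum>i\<in>?A. of_bool (d dvd fst (S ! i)) * of_bool (d < fst (S ! i))) =
        (\<Sum>i\<in>?A. of_bool (?P i) :: real)"
      by (simp only: of_bool_conj)
    also have "\<dots> = real (card (?A \<inter> Collect ?P))"
      by (rule sum_of_bool_eq; rule fin)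
    also have "?A \<inter> Collect ?P =
        {i. i < length S \<and> snd (S ! i) = 0 \<and> d dvd fst (S ! i) \<and> d < fst (S ! i)}"
      by blast
    finally show ?thesis by (simp add: divisor_score_def)
  qed
  have bound: "?c d \<le> length S" for d
  proof -
    have "?c d \<le> card {..<length S}" by (intro card_mono) auto
    then show ?thesis by simp
  qed
  obtain a where "a \<in> I" using assms by blast
  moreover have "\<forall>e. e \<in> I \<longrightarrow> ?c e < Suc (length S)"
    by (intro allI impI le_imp_less_Suc bound)
  ultimately have "\<exists>d. d \<in> I \<and> (\<forall>e. e \<in> I \<longrightarrow> ?c e \<le> ?c d)"
    by (rule ex_has_greatest_nat)
  then obtain d where d: "d \<in> I" "\<And>e. e \<in> I \<Longrightarrow> ?c e \<le> ?c d"
    by blast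
  have "divisor_score S e \<le> divisor_score S d" if "e \<in> I" for e
    unfolding score using d(2)[OF that] by (intro mult_left_mono) auto
  then have "is_arg_max (divisor_score S) (\<lambda>d. d \<in> I) d"
    using d(1) by (auto simp: is_arg_max_def not_less)
  then show ?thesis unfolding erm_index_def by (rule LeastI)
qed

lemma empirical_risk_hyp:
  assumes "d \<in> instance_space" "S = labelled_sample xs"
  shows "empirical_risk S (hyp d) =
    1 / real (length S) * real (card {i. i < length S \<and> snd (S ! i) = 0}) - divisor_score S d"
proof -
  have "(\<Sum>i<length S. of_bool (hyp d (fst (S ! i)) \<noteq> snd (S ! i))) =
    (\<Sum>i<length S. if snd (S ! i) = 0
       then 1 - of_bool (d dvd fst (S ! i)) * of_bool (d < fst (S ! i)) else (0::real))"
  proof (rule sum.cong)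
    fix i assume i: "i \<in> {..<length S}"
    define x where "x = xs ! i"
    have "fst (S ! i) = x" "snd (S ! i) = prime_label x"
      using i assms(2) by (auto simp: labelled_sample_def x_def)
    moreover have "\<not> (d dvd x \<and> d < x)" if "prime x"
      using that assms(1) by (auto simp: prime_nat_iff instance_space_def)
    ultimately show "of_bool (hyp d (fst (S ! i)) \<noteq> snd (S ! i)) = (if snd (S ! i) = 0
       then 1 - of_bool (d dvd fst (S ! i)) * of_bool (d < fst (S ! i)) else (0::real))"
      by (auto simp: hyp_def prime_label_def)
  qed simp
  also have "\<dots> = (\<Sum>i | i < length S \<and> snd (S ! i) = 0.
       1 - of_bool (d dvd fst (S ! i)) * of_bool (d < fst (S ! i)))"
    by (rule sum.mono_neutral_cong_right) (simp_all add: subset_eq Ball_def)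
  also have "\<dots> = real (card {i. i < length S \<and> snd (S ! i) = 0}) -
      (\<Sum>i | i < length S \<and> snd (S ! i) = 0.
         of_bool (d dvd fst (S ! i)) * of_bool (d < fst (S ! i)))"
    by (simp add: sum_subtractf)
  finally show ?thesis
    unfolding empirical_risk_def divisor_score_def by (simp only: right_diff_distrib)
qed

lemma erm_hyp_minimizes_empirical_risk:
  assumes "I \<subseteq> instance_space" "d \<in> I"
  shows "empirical_risk (labelled_sample xs) (erm_hyp I (labelled_sample xs))
    \<le> empirical_risk (labelled_sample xs) (hyp d)"
proof -
  let ?S = "labelled_sample xs"
  have max: "is_arg_max (divisor_score ?S) (\<lambda>d. d \<in> I) (erm_index I ?S)"
    using erm_index_is_arg_max assms(2) by blast
  then have "erm_index I ?S \<in> I" "divisor_score ?S d \<le> divisor_score ?S (erm_index I ?S)"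
    using assms(2) by (auto simp: is_arg_max_def not_less)
  then show ?thesis
    using assms unfolding erm_hyp_def
    by (subst (1 2) empirical_risk_hyp[OF _ refl]) auto
qed

end

theory Submission
  imports Defs "HOL-Real_Asymp.Real_Asymp"
begin

text \<open>
  The points at which \<open>hyp d\<close> says 0 are the proper multiples of \<open>d\<close>, all of them composite. So
  \<open>hyp d\<close> errs exactly on the composites that are not proper multiples of \<open>d\<close>. The primes have
  density zero, whence the error of \<open>hyp d\<close> on \<open>{2..n}\<close> tends to \<open>1 - 1/d\<close>
  (\<open>gen_error_hyp_tendsto\<close>). In particular \<open>hyp 2\<close> has limiting error \<open>1/2\<close>, and the theorem follows once
  empirical risk minimization selects the index 2 with a probability that is close enough to 1.

  The score of \<open>d\<close> is the fraction of the sample that consists of proper multiples of \<open>d\<close>. Its mean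
  is about \<open>1/2\<close> for \<open>d = 2\<close> and at most about \<open>1/3\<close> for \<open>d \<ge> 3\<close>, so the index 2 is ahead of any
  rival by a constant on average. Hoeffding's inequality bounds the probability that a given rival
  catches up on a sample of size \<open>k\<close> by \<open>exp (-k/288)\<close> (\<open>prob_lead_nonpos\<close>). Only the rivals up to \<open>n\<close>
  matter, because a larger one scores as little as \<open>n\<close> itself, namely 0; a union bound over them
  costs a factor \<open>n\<close> (\<open>prob_erm_index_neq_2\<close>).

  For sample sizes that grow faster than \<open>ln n\<close> the result \<open>n * exp (-k/288)\<close> is eventually below
  \<open>1/n\<^sup>2\<close>. This tends to 0, which yields convergence in probability, and it is summable, which
  yields almost sure convergence by the Borel-Cantelli lemma. Both growth rates in the theorem exceed
  \<open>ln n\<close>.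
\<close>

section \<open>The primes have density zero\<close>

lemma prod_primes_dvd:
  fixes n :: nat
  assumes "finite A" "\<And>p. p \<in> A \<Longrightarrow> prime p \<and> p dvd n"
  shows "\<Prod>A dvd n"
  using assms
proof (induction A rule: finite_induct)
  case (insert p A)
  have "coprime p (\<Prod>A)"
    using insert.hyps insert.prems by (intro prod_coprime_right) (metis insertCI primes_coprime)
  then show ?case
    using insert by (simp add: divides_mult)
qed simp

text \<open>Chebyshev's argument: every prime in \<open>(N, 2N]\<close> divides the numerator of the central
  binomial coefficient but not its denominator, and the coefficient is at most \<open>4 ^ N\<close>.\<close>

lemma power_card_primes_between_le:
  fixes N :: nat
  shows "N ^ card {p. prime p \<and> N < p \<and> p \<le> 2 * N} \<le> 4 ^ N"
proof -
  let ?P = "{p. prime p \<and> N < p \<and> p \<le> 2 * N}"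
  have fin: "finite ?P"
    by (rule finite_subset[of _ "{..2 * N}"]) auto
  have dvd: "p dvd (2 * N choose N)" if "p \<in> ?P" for p
  proof -
    have "p dvd fact (2 * N)"
      using that by (simp add: prime_dvd_fact_iff)
    also have "(fact (2 * N) :: nat) = fact N * fact N * (2 * N choose N)"
      using binomial_fact_lemma[of N "2 * N"] by (simp add: mult_2)
    finally show ?thesis
      using that by (auto simp: prime_dvd_mult_iff prime_dvd_fact_iff)
  qed
  have "N ^ card ?P \<le> \<Prod>?P"
    using prod_mono[of ?P "\<lambda>_. N" "\<lambda>p. p"] by simp
  also have "\<dots> \<le> (2 * N choose N)"
    using prod_primes_dvd[OF fin] dvd by (intro dvd_imp_le) auto
  also have "\<dots> \<le> 4 ^ N"
    using binomial_le_pow2[of "2 * N" N] by (simp add: power_mult)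
  finally show ?thesis .
qed

definition prime_count :: "nat \<Rightarrow> nat" where
  "prime_count n = card {p. prime p \<and> p \<le> n}"

lemma finite_primes_upto: "finite {p::nat. prime p \<and> p \<le> n}"
  by (rule finite_subset[of _ "{..n}"]) auto

lemma prime_count_mono: "k \<le> n \<Longrightarrow> prime_count k \<le> prime_count n"
  unfolding prime_count_def by (rule card_mono[OF finite_primes_upto]) auto

lemma prime_count_le: "prime_count n \<le> n"
proof -
  have "prime_count n \<le> card {1..n}"
    unfolding prime_count_def
    by (rule card_mono) (auto simp: prime_gt_0_nat Suc_leI)
  then show ?thesis by simp
qed

text \<open>Chebyshev's bound for \<open>N = 2 ^ k\<close>, after taking logarithms to base 2.\<close>

lemma prime_count_double_pow2:
  "k * prime_count (2 ^ Suc k) \<le> k * prime_count (2 ^ k) + 2 * 2 ^ k"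
proof -
  let ?P = "{p::nat. prime p \<and> 2 ^ k < p \<and> p \<le> 2 * 2 ^ k}"
  have "(2::nat) ^ (k * card ?P) \<le> 2 ^ (2 * 2 ^ k)"
    using power_card_primes_between_le[of "2 ^ k"] by (simp add: power_mult)
  then have *: "k * card ?P \<le> 2 * 2 ^ k"
    by (rule power_le_imp_le_exp[rotated]) simp
  have "{p::nat. prime p \<and> p \<le> 2 ^ Suc k} = {p. prime p \<and> p \<le> 2 ^ k} \<union> ?P"
    by auto
  then have "prime_count (2 ^ Suc k) \<le> prime_count (2 ^ k) + card ?P"
    unfolding prime_count_def by (simp only: card_Un_le)
  then have "k * prime_count (2 ^ Suc k) \<le> k * (prime_count (2 ^ k) + card ?P)"
    by (rule mult_left_mono) simp
  with * show ?thesis by (simp add: algebra_simps)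
qed

text \<open>The constant 4 reproduces itself: doubling adds \<open>2 * 2 ^ k\<close> to \<open>4 * 2 ^ k\<close>, and passing from the
  factor \<open>k\<close> to \<open>Suc k\<close> costs at most \<open>4/3\<close> once \<open>k \<ge> 3\<close>, so the new bound is
  \<open>(4/3) * 6 * 2 ^ k = 4 * 2 ^ Suc k\<close>. For smaller \<open>k\<close> there are at most \<open>n\<close> primes up to \<open>n\<close>.\<close>

lemma prime_count_pow2_bound: "k * prime_count (2 ^ k) \<le> 4 * 2 ^ k"
proof (induction k)
  case (Suc k)
  show ?case
  proof (cases "k \<ge> 3")
    case False
    then have "Suc k * prime_count (2 ^ Suc k) \<le> 4 * 2 ^ Suc k"
      using prime_count_le[of "2 ^ Suc k"] by (intro mult_mono) auto
    then show ?thesis .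
  next
    case True
    have "k * prime_count (2 ^ Suc k) \<le> 6 * 2 ^ k"
      using prime_count_double_pow2[of k] Suc.IH by linarith
    then have "3 * (k * prime_count (2 ^ Suc k)) \<le> 18 * 2 ^ k"
      by linarith
    moreover have "3 * (Suc k * prime_count (2 ^ Suc k)) \<le> 4 * (k * prime_count (2 ^ Suc k))"
      using True by (simp only: mult.assoc[symmetric]) (intro mult_right_mono; simp)
    ultimately have "3 * (Suc k * prime_count (2 ^ Suc k)) \<le> 24 * 2 ^ k"
      using \<open>k * prime_count (2 ^ Suc k) \<le> 6 * 2 ^ k\<close> by linarith
    then show ?thesis by simp
  qed
qed simp

lemma prime_count_bound:
  assumes "n > 0"
  shows "prime_count n * log 2 n \<le> 8 * real n"
proof -
  define k where "k = nat \<lfloor>log 2 n\<rfloor>"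
  have log0: "log 2 n \<ge> 0" using assms by simp
  have "real k \<le> log 2 n" "log 2 n \<le> real (Suc k)"
    using log0 unfolding k_def by linarith+
  then have k: "2 ^ k \<le> n" "n \<le> 2 ^ Suc k"
    using assms by (simp_all add: le_log_iff log_le_iff powr_realpow flip: of_nat_le_iff
      del: power_Suc of_nat_Suc)
  have "prime_count n * log 2 n \<le> prime_count (2 ^ Suc k) * real (Suc k)"
    using prime_count_mono[OF k(2)] \<open>log 2 n \<le> real (Suc k)\<close> log0 by (intro mult_mono) auto
  also have "\<dots> = real (Suc k * prime_count (2 ^ Suc k))"
    by (simp only: of_nat_mult mult.commute)
  also have "\<dots> \<le> real (8 * 2 ^ k)"
    using prime_count_pow2_bound[of "Suc k"] by (subst of_nat_le_iff) simp
  also have "\<dots> \<le> 8 * real n"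
    using k(1) by (simp flip: of_nat_le_iff)
  finally show ?thesis .
qed

text \<open>The denominator is \<open>n - 1\<close> because this is the number of points of \<open>{2..n}\<close>.\<close>

lemma prime_density_zero: "(\<lambda>n. real (prime_count n) / real (n - 1)) \<longlonglongrightarrow> 0"
proof (rule tendsto_sandwich[where f = "\<lambda>_. 0"])
  show "\<forall>\<^sub>F n in sequentially. real (prime_count n) / real (n - 1) \<le> 16 / log 2 (real n)"
    using eventually_ge_at_top[of 2]
  proof eventually_elim
    case (elim n)
    then have "log 2 (real n) > 0" "real (n - 1) > 0" by simp_all
    moreover have "prime_count n * log 2 n \<le> 16 * real (n - 1)"
      using prime_count_bound[of n] elim by (simp add: of_nat_diff)
    ultimately show ?case
      by (simp add: field_simps)
  qed
  show "(\<lambda>n. 16 / log 2 (real n)) \<longlonglongrightarrow> 0"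
    by real_asymp
qed auto

section \<open>The limiting error of a fixed hypothesis\<close>

lemma card_proper_multiples:
  fixes d n :: nat
  assumes "2 \<le> d"
  shows "card {x \<in> {2..n}. d dvd x \<and> d < x} = n div d - 1"
proof -
  have "{x \<in> {2..n}. d dvd x \<and> d < x} = (\<lambda>k. d * k) ` {2..n div d}"
  proof (intro equalityI subsetI)
    fix x assume x: "x \<in> {x \<in> {2..n}. d dvd x \<and> d < x}"
    then obtain k where "x = d * k" by auto
    with x assms show "x \<in> (\<lambda>k. d * k) ` {2..n div d}"
      by (intro image_eqI[of _ _ k]) (auto simp: less_eq_div_iff_mult_less_eq mult.commute
          intro: Suc_leI)
  next
    fix x assume "x \<in> (\<lambda>k. d * k) ` {2..n div d}"
    then obtain k where "k \<in> {2..n div d}" "x = d * k" by (rule imageE)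
    then have k: "x = d * k" "2 \<le> k" "k \<le> n div d" by simp_all
    have "d * 2 \<le> d * k" using k by simp
    then have "2 \<le> d * k" "d < d * k" using assms by linarith+
    moreover have "d * k \<le> n"
      using k assms by (simp add: less_eq_div_iff_mult_less_eq mult.commute)
    ultimately show "x \<in> {x \<in> {2..n}. d dvd x \<and> d < x}"
      unfolding k(1) mem_Collect_eq atLeastAtMost_iff by (intro conjI dvd_triv_left)
  qed
  moreover have "inj_on (\<lambda>k. d * k) {2..n div d}"
    using assms by (auto simp: inj_on_def)
  ultimately show ?thesis by (simp add: card_image)
qed

lemma not_prime_proper_multiple:
  fixes d x :: nat
  assumes "2 \<le> d" "d dvd x" "d < x"
  shows "\<not> prime x"
  using assms by (auto simp: prime_nat_iff)

text \<open>The proper multiples of \<open>d\<close>, the primes, and the points of error partition \<open>{2..n}\<close>.\<close>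

lemma gen_error_hyp:
  assumes "2 \<le> d" "2 \<le> n"
  shows "gen_error (pmf_of_set {2..n}) (hyp d) =
    1 - real (n div d - 1) / real (n - 1) - real (prime_count n) / real (n - 1)"
proof -
  let ?E = "{x \<in> {2..n}. hyp d x \<noteq> prime_label x}"
  let ?M = "{x \<in> {2..n}. d dvd x \<and> d < x}"
  let ?P = "{p. prime p \<and> p \<le> n}"
  have split: "{2..n} = ?E \<union> (?M \<union> ?P)"
    using not_prime_proper_multiple[OF assms(1)]
    by (auto simp: hyp_def prime_label_def prime_ge_2_nat)
  have disj: "?E \<inter> (?M \<union> ?P) = {}" "?M \<inter> ?P = {}"
    using not_prime_proper_multiple[OF assms(1)]
    by (auto simp: hyp_def prime_label_def)
  have "card {2..n} = card ?E + card (?M \<union> ?P)"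
    using disj finite_primes_upto[of n] by (subst split, subst card_Un_disjoint) auto
  also have "card (?M \<union> ?P) = card ?M + card ?P"
    using disj finite_primes_upto[of n] by (subst card_Un_disjoint) auto
  finally have "n - 1 = card ?E + (n div d - 1) + prime_count n"
    using card_proper_multiples[OF assms(1)] by (simp add: prime_count_def)
  then have "real (card ?E) = real (n - 1) - real (n div d - 1) - real (prime_count n)"
    by linarith
  moreover have "{2..n} \<inter> {x. hyp d x \<noteq> prime_label x} = ?E"
    by auto
  then have "gen_error (pmf_of_set {2..n}) (hyp d) = real (card ?E) / real (n - 1)"
    using assms by (simp add: gen_error_def measure_pmf_of_set)
  ultimately show ?thesis
    using assms by (simp add: diff_divide_distrib)
qed

lemma gen_error_hyp_tendsto:
  assumes "2 \<le> d"
  shows "(\<lambda>n. gen_error (pmf_of_set {2..n}) (hyp d)) \<longlonglongrightarrow> 1 - 1 / real d"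
proof -
  have "(\<lambda>n. real (n div d - 1) / real (n - 1)) \<longlonglongrightarrow> 1 / real d"
  proof (rule tendsto_sandwich)
    show "\<forall>\<^sub>F n in sequentially. (real n / real d - 2) / (real n - 1) \<le> real (n div d - 1) / real (n - 1)"
      using eventually_ge_at_top[of "2 * d"]
    proof eventually_elim
      case (elim n)
      have "real n / real d \<le> real (n div d) + 1"
        using dividend_less_times_div[of d n] assms
        by (simp add: field_simps flip: of_nat_mult of_nat_add of_nat_less_iff)
      then show ?case
        using elim assms
        by (simp add: of_nat_diff del: divide_divide_eq_left) (simp add: divide_right_mono)
    qed
    show "\<forall>\<^sub>F n in sequentially. real (n div d - 1) / real (n - 1) \<le> (real n / real d) / (real n - 1)"
      using eventually_ge_at_top[of "2 * d"]
    proof eventually_elim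
      case (elim n)
      have *: "real (n div d - 1) \<le> real n / real d"
        using of_nat_div_le_of_nat[of n d, where ?'a = real] by linarith
      have "real n - 1 = real (n - 1)"
        using elim assms by simp
      with * show ?case
        by (simp only: divide_right_mono of_nat_0_le_iff)
    qed
    show "(\<lambda>n. (real n / real d - 2) / (real n - 1)) \<longlonglongrightarrow> 1 / real d"
      using assms by (real_asymp simp: field_simps)
    show "(\<lambda>n. (real n / real d) / (real n - 1)) \<longlonglongrightarrow> 1 / real d"
      using assms by (real_asymp simp: field_simps)
  qed
  from tendsto_diff[OF tendsto_diff[OF tendsto_const[of 1] this] prime_density_zero]
  have "(\<lambda>n. 1 - real (n div d - 1) / real (n - 1) - real (prime_count n) / real (n - 1))
      \<longlonglongrightarrow> 1 - 1 / real d"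
    by simp
  then show ?thesis
    by (rule Lim_transform_eventually)
      (use eventually_ge_at_top[of 2] in eventually_elim, simp add: gen_error_hyp[OF assms])
qed

section \<open>When empirical risk minimization selects 2\<close>

text \<open>The contribution of a sample point \<open>x\<close> to the score of 2 minus the score of \<open>d\<close>, up to the
  normalization by the sample size.\<close>

definition lead :: "nat \<Rightarrow> nat \<Rightarrow> real" where
  "lead d x = of_bool (2 dvd x \<and> 2 < x) - of_bool (d dvd x \<and> d < x)"

text \<open>Proper multiples of \<open>d \<ge> 2\<close> are composite, hence labelled 0. So the score is a sum over the whole
  sample, to which concentration inequalities for independent summands apply.\<close>

lemma divisor_score_labelled_sample:
  assumes "2 \<le> d"
  shows "divisor_score (labelled_sample xs) d =
    1 / real (length xs) * (\<Sum>i<length xs. of_bool (d dvd xs ! i \<and> d < xs ! i))"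
proof -
  have "(\<Sum>i | i < length xs \<and> prime_label (xs ! i) = 0. of_bool (d dvd xs ! i \<and> d < xs ! i) :: real)
      = (\<Sum>i<length xs. of_bool (d dvd xs ! i \<and> d < xs ! i))"
    using not_prime_proper_multiple[OF assms]
    by (intro sum.mono_neutral_left) (auto simp: prime_label_def)
  moreover have "{i. i < length (labelled_sample xs) \<and> snd (labelled_sample xs ! i) = 0} =
      {i. i < length xs \<and> prime_label (xs ! i) = 0}"
    by (auto simp: labelled_sample_def)
  moreover have "(\<Sum>i | i < length xs \<and> prime_label (xs ! i) = 0.
        of_bool (d dvd fst (labelled_sample xs ! i)) * of_bool (d < fst (labelled_sample xs ! i)) :: real)
      = (\<Sum>i | i < length xs \<and> prime_label (xs ! i) = 0. of_bool (d dvd xs ! i \<and> d < xs ! i))"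
    by (intro sum.cong) (auto simp: labelled_sample_def)
  ultimately show ?thesis
    unfolding divisor_score_def by (simp add: labelled_sample_def)
qed

text \<open>Finitely many comparisons decide: if no instance exceeds \<open>n\<close>, then a rival \<open>d > n\<close> has no proper
  multiple in the sample, and neither has \<open>n\<close>, so it is beaten as soon as \<open>n\<close> is.\<close>

lemma erm_index_eq_2:
  assumes I: "I \<subseteq> {2..}" "2 \<in> I"
    and xs: "set xs \<subseteq> {..n}" and "3 \<le> n"
    and lead: "\<And>d. d \<in> {3..n} \<Longrightarrow> 0 < (\<Sum>i<length xs. lead d (xs ! i))"
  shows "erm_index I (labelled_sample xs) = 2"
proof -
  let ?S = "labelled_sample xs"
  have "divisor_score ?S d < divisor_score ?S 2" if "d \<in> I" "d \<noteq> 2" for d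
  proof -
    have d: "3 \<le> d" using that I by force
    have pos: "0 < (\<Sum>i<length xs. lead d (xs ! i))"
    proof (cases "d \<le> n")
      case False
      have "lead d (xs ! i) = lead n (xs ! i)" if "i < length xs" for i
        using nth_mem[OF that] xs False by (auto simp: lead_def)
      then show ?thesis
        using lead[of n] \<open>3 \<le> n\<close> by simp
    qed (use lead d in auto)
    then have "length xs \<noteq> 0" by auto
    then have "0 < 1 / real (length xs) * (\<Sum>i<length xs. lead d (xs ! i))"
      using pos by (intro mult_pos_pos) auto
    also have "\<dots> = divisor_score ?S 2 - divisor_score ?S d"
      using d by (simp add: divisor_score_labelled_sample lead_def sum_subtractf diff_divide_distrib)
    finally show ?thesis by simp
  qed
  moreover have "is_arg_max (divisor_score ?S) (\<lambda>d. d \<in> I) (erm_index I ?S)"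
    using I by (intro erm_index_is_arg_max) auto
  ultimately show ?thesis
    using I(2) by (auto simp: is_arg_max_def)
qed

section \<open>Concentration of the scores\<close>

text \<open>The mean is \<open>(n div 2 - n div d) / (n - 1)\<close>. By \<open>n div 2 \<ge> (n - 1)/2\<close> and \<open>n div d \<le> n/3\<close> it is at
  least \<open>(n - 3) / (6 * (n - 1))\<close>, which increases with \<open>n\<close> and equals \<open>1/12\<close> at \<open>n = 5\<close>.\<close>

lemma expectation_lead:
  assumes "3 \<le> d" "d \<le> n" "5 \<le> n"
  shows "1 / 12 \<le> measure_pmf.expectation (pmf_of_set {2..n}) (lead d)"
proof -
  have hits: "(\<Sum>x\<in>{2..n}. of_bool (e dvd x \<and> e < x)) = real (n div e - 1)" if "2 \<le> e" for e
    using card_proper_multiples[OF that, of n] by (simp add: Int_def)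
  have "measure_pmf.expectation (pmf_of_set {2..n}) (lead d) = (\<Sum>x\<in>{2..n}. lead d x) / real (n - 1)"
    using assms by (subst integral_pmf_of_set) auto
  also have "(\<Sum>x\<in>{2..n}. lead d x) = real (n div 2 - 1) - real (n div d - 1)"
    using assms unfolding lead_def by (subst sum_subtractf) (simp only: hits)
  finally have E: "measure_pmf.expectation (pmf_of_set {2..n}) (lead d) =
      (real (n div 2 - 1) - real (n div d - 1)) / real (n - 1)" .
  have "1 \<le> n div d"
    using assms by (simp add: less_eq_div_iff_mult_less_eq)
  moreover have "n div d \<le> n div 3"
    using assms by (intro div_le_mono2) auto
  ultimately have "n - 1 + 12 * (n div d - 1) \<le> 12 * (n div 2 - 1)"
    using assms by linarith
  then have "real (n - 1 + 12 * (n div d - 1)) \<le> real (12 * (n div 2 - 1))"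
    by (rule of_nat_mono)
  then have "real (n - 1) \<le> 12 * (real (n div 2 - 1) - real (n div d - 1))"
    by (simp only: of_nat_add of_nat_mult of_nat_numeral right_diff_distrib)
  then show ?thesis
    using assms unfolding E by (simp add: field_simps)
qed

text \<open>Hoeffding's inequality for \<open>k\<close> independent terms in \<open>[-1, 1]\<close> whose sum would have to fall short
  of its mean by at least \<open>k/12\<close>: the exponent is \<open>-2 * (k/12)\<^sup>2 / (4 * k)\<close>.\<close>

lemma (in prob_space) prob_lead_nonpos:
  assumes indep: "indep_vars (\<lambda>_. count_space UNIV) X {..<k}"
    and distr: "\<And>i. i < k \<Longrightarrow> distr M (count_space UNIV) (X i) = measure_pmf (pmf_of_set {2..n})"
    and "0 < k" "3 \<le> d" "d \<le> n" "5 \<le> n"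
  shows "prob {\<omega> \<in> space M. (\<Sum>i<k. lead d (X i \<omega>)) \<le> 0} \<le> exp (- real k / 288)"
proof -
  have X [measurable]: "X i \<in> M \<rightarrow>\<^sub>M count_space UNIV" if "i < k" for i
    using indep that by (auto simp: indep_vars_def)
  define \<mu> where "\<mu> = (\<Sum>i<k. expectation (\<lambda>\<omega>. lead d (X i \<omega>)))"
  interpret Hoeffding_ineq M "{..<k}" "\<lambda>i \<omega>. lead d (X i \<omega>)" "\<lambda>_. -1" "\<lambda>_. 1" \<mu>
  proof unfold_locales
    show "indep_vars (\<lambda>_. borel) (\<lambda>i \<omega>. lead d (X i \<omega>)) {..<k}"
      by (rule indep_vars_compose2[OF indep]) auto
  qed (auto simp: \<mu>_def lead_def)
  have "1 / 12 \<le> expectation (\<lambda>\<omega>. lead d (X i \<omega>))" if "i < k" for i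
  proof -
    have "expectation (\<lambda>\<omega>. lead d (X i \<omega>)) =
        integral\<^sup>L (distr M (count_space UNIV) (X i)) (lead d)"
      using that by (subst integral_distr) auto
    then show ?thesis
      using expectation_lead[of d n] assms that by simp
  qed
  then have \<mu>: "real k / 12 \<le> \<mu>"
    unfolding \<mu>_def using sum_bounded_below[of "{..<k}" "1 / 12 :: real"] by simp
  have "prob {\<omega> \<in> space M. (\<Sum>i<k. lead d (X i \<omega>)) \<le> 0}
      \<le> prob {\<omega> \<in> space M. (\<Sum>i<k. lead d (X i \<omega>)) \<le> \<mu> - real k / 12}"
    using \<mu> by (intro finite_measure_mono) (auto, measurable)
  also have "\<dots> \<le> exp (-2 * (real k / 12)\<^sup>2 / (\<Sum>i<k. (1 - (-1))\<^sup>2))"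
    using \<open>0 < k\<close> by (intro Hoeffding_ineq_le) auto
  also have "-2 * (real k / 12)\<^sup>2 / (\<Sum>i<k. (1 - (-1))\<^sup>2) = - real k / 288"
    using \<open>0 < k\<close> by (simp add: power2_eq_square field_simps)
  finally show ?thesis .
qed

text \<open>There are only countably many samples, so it suffices to look at the preimages of single lists.
  This makes the events that involve \<open>erm_index\<close> measurable.\<close>

lemma (in prob_space) measurable_map_upt:
  fixes X :: "nat \<Rightarrow> 'a \<Rightarrow> 'b :: countable"
  assumes "\<And>i. i < k \<Longrightarrow> X i \<in> M \<rightarrow>\<^sub>M count_space UNIV"
  shows "(\<lambda>\<omega>. map (\<lambda>i. X i \<omega>) [0..<k]) \<in> M \<rightarrow>\<^sub>M count_space UNIV"
proof -
  have "(\<lambda>\<omega>. map (\<lambda>i. X i \<omega>) [0..<k]) -` {xs} \<inter> space M \<in> sets M" for xs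
  proof (cases "length xs = k")
    case True
    have "map (\<lambda>i. X i \<omega>) [0..<k] = xs \<longleftrightarrow> (\<forall>i\<in>{..<k}. X i \<omega> = xs ! i)" for \<omega>
      by (simp add: list_eq_iff_nth_eq True Ball_def)
    then have "(\<lambda>\<omega>. map (\<lambda>i. X i \<omega>) [0..<k]) -` {xs} \<inter> space M =
        {\<omega> \<in> space M. \<forall>i\<in>{..<k}. X i \<omega> = xs ! i}"
      by blast
    also have "\<dots> \<in> sets M"
      using assms by (intro sets.sets_Collect_finite_All) (auto intro: measurable_sets_Collect)
    finally show ?thesis .
  next
    case False
    then have "(\<lambda>\<omega>. map (\<lambda>i. X i \<omega>) [0..<k]) -` {xs} \<inter> space M = {}"
      by auto
    then show ?thesis by simp
  qed
  then show ?thesis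
    by (simp add: measurable_count_space_eq_countable)
qed

text \<open>A union bound over the rivals in \<open>{3..n}\<close>. The inclusion of events holds only almost surely,
  since the distribution confines the instances to \<open>{2..n}\<close> up to a null set.\<close>

lemma (in prob_space) prob_erm_index_neq_2:
  assumes I: "I \<subseteq> {2..}" "2 \<in> I"
    and indep: "indep_vars (\<lambda>_. count_space UNIV) X {..<k}"
    and distr: "\<And>i. i < k \<Longrightarrow> distr M (count_space UNIV) (X i) = measure_pmf (pmf_of_set {2..n})"
    and "0 < k" "5 \<le> n"
  defines "E \<equiv> {\<omega> \<in> space M. erm_index I (labelled_sample (map (\<lambda>i. X i \<omega>) [0..<k])) \<noteq> 2}"
  shows "E \<in> events" and "prob E \<le> real n * exp (- real k / 288)"
proof -
  have X [measurable]: "X i \<in> M \<rightarrow>\<^sub>M count_space UNIV" if "i < k" for i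
    using indep that by (auto simp: indep_vars_def)
  have [measurable]: "(\<lambda>\<omega>. map (\<lambda>i. X i \<omega>) [0..<k]) \<in> M \<rightarrow>\<^sub>M count_space UNIV"
    by (rule measurable_map_upt) (rule X)
  show "E \<in> events"
    unfolding E_def by measurable
  let ?F = "\<lambda>d. {\<omega> \<in> space M. (\<Sum>i<k. lead d (X i \<omega>)) \<le> 0}"
  have F: "?F d \<in> events" for d
    by measurable
  have "AE \<omega> in M. X i \<omega> \<in> {2..n}" if "i < k" for i
  proof -
    have "AE x in distr M (count_space UNIV) (X i). x \<in> {2..n}"
      using assms(6) that by (subst distr) (auto simp: AE_measure_pmf_iff)
    then show ?thesis
      using that by (subst (asm) AE_distr_iff) auto
  qed
  then have "AE \<omega> in M. \<forall>i\<in>{..<k}. X i \<omega> \<in> {2..n}"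
    by (intro AE_finite_allI) auto
  then have "AE \<omega> in M. \<omega> \<in> E \<longrightarrow> \<omega> \<in> (\<Union>d\<in>{3..n}. ?F d)"
  proof eventually_elim
    case (elim \<omega>)
    show ?case
    proof
      assume \<omega>: "\<omega> \<in> E"
      show "\<omega> \<in> (\<Union>d\<in>{3..n}. ?F d)"
      proof (rule ccontr)
        assume "\<omega> \<notin> (\<Union>d\<in>{3..n}. ?F d)"
        then have "0 < (\<Sum>i<k. lead d (X i \<omega>))" if "d \<in> {3..n}" for d
          using \<omega> that by (auto simp: E_def not_le)
        then have "erm_index I (labelled_sample (map (\<lambda>i. X i \<omega>) [0..<k])) = 2"
          using elim \<open>5 \<le> n\<close> by (intro erm_index_eq_2[OF I, of _ n]) auto
        then show False
          using \<omega> by (simp add: E_def)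
      qed
    qed
  qed
  then have "prob E \<le> prob (\<Union>d\<in>{3..n}. ?F d)"
    using F by (intro finite_measure_mono_AE) auto
  also have "\<dots> \<le> (\<Sum>d\<in>{3..n}. prob (?F d))"
    using F by (intro finite_measure_subadditive_finite) auto
  also have "\<dots> \<le> (\<Sum>d\<in>{3..n}. exp (- real k / 288))"
    using prob_lead_nonpos[OF indep distr] assms by (intro sum_mono) auto
  also have "\<dots> \<le> real n * exp (- real k / 288)"
    by (simp add: mult_right_mono)
  finally show "prob E \<le> real n * exp (- real k / 288)" .
qed

section \<open>Convergence of the generalization error\<close>

text \<open>Eventually \<open>m n \<ge> 864 * ln n\<close>, where \<open>864 = 3 * 288\<close> makes the exponential at most \<open>1 / n ^ 3\<close>.
  The power 3 leaves a summable bound after multiplication by \<open>n\<close>.\<close>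

lemma (in prob_space) eventually_prob_erm_index_neq_2:
  fixes X :: "nat \<Rightarrow> nat \<Rightarrow> 'a \<Rightarrow> nat"
  assumes I: "I \<subseteq> {2..}" "2 \<in> I"
    and pos: "\<And>n. 2 \<le> n \<Longrightarrow> 0 < m n"
    and indep: "\<And>n. 2 \<le> n \<Longrightarrow> indep_vars (\<lambda>_. count_space UNIV) (X n) {..<m n}"
    and distr: "\<And>n i. 2 \<le> n \<Longrightarrow> i < m n \<Longrightarrow>
           distr M (count_space UNIV) (X n i) = measure_pmf (pmf_of_set {2..n})"
    and m: "(\<lambda>n. real (m n)) \<in> \<omega>(\<lambda>n. ln (real n))"
  defines "E \<equiv> \<lambda>n. {\<omega> \<in> space M. erm_index I (labelled_sample (map (\<lambda>i. X n i \<omega>) [0..<m n])) \<noteq> 2}"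
  shows "\<forall>\<^sub>F n in sequentially. E n \<in> events \<and> prob (E n) \<le> 1 / real n ^ 2"
  using smallomegaD[OF m, of 864] eventually_ge_at_top[of 5]
proof eventually_elim
  case (elim n)
  then have n: "2 \<le> n" "0 < real n"
    by simp_all
  have m: "864 * ln (real n) \<le> real (m n)"
    using elim(1) n by simp
  note bound = prob_erm_index_neq_2[OF I indep[OF n(1)] distr[OF n(1)] pos[OF n(1)] elim(2)]
  have "- real (m n) / 288 \<le> - 3 * ln (real n)"
    using m by simp
  also have "\<dots> = ln (1 / real n ^ 3)"
    using n by (simp add: ln_div ln_realpow)
  finally have "exp (- real (m n) / 288) \<le> exp (ln (1 / real n ^ 3))"
    by simp
  then have "real n * exp (- real (m n) / 288) \<le> real n * (1 / real n ^ 3)"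
    using n by (intro mult_left_mono) auto
  also have "\<dots> = 1 / real n ^ 2"
    using n by (simp add: field_simps power2_eq_square power3_eq_cube)
  finally show ?case
    using bound unfolding E_def by (blast intro: order_trans)
qed

text \<open>Outside the exceptional event \<open>E n\<close> the random error \<open>L n\<close> is the deterministic error of \<open>hyp 2\<close>,
  so both modes of convergence reduce to the bound on the probability of \<open>E n\<close>.\<close>

lemma (in prob_space) erm_error_tendsto:
  fixes X :: "nat \<Rightarrow> nat \<Rightarrow> 'a \<Rightarrow> nat"
  assumes I: "I \<subseteq> {2..}" "2 \<in> I"
    and pos: "\<And>n. 2 \<le> n \<Longrightarrow> 0 < m n"
    and indep: "\<And>n. 2 \<le> n \<Longrightarrow> indep_vars (\<lambda>_. count_space UNIV) (X n) {..<m n}"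
    and distr: "\<And>n i. 2 \<le> n \<Longrightarrow> i < m n \<Longrightarrow>
           distr M (count_space UNIV) (X n i) = measure_pmf (pmf_of_set {2..n})"
    and m: "(\<lambda>n. real (m n)) \<in> \<omega>(\<lambda>n. ln (real n))"
    and L: "\<And>n \<omega>. L n \<omega> = gen_error (pmf_of_set {2..n})
             (erm_hyp I (labelled_sample (map (\<lambda>i. X n i \<omega>) [0..<m n])))"
  shows "tendsto_in_prob M L (1 / 2)" and "AE \<omega> in M. (\<lambda>n. L n \<omega>) \<longlonglongrightarrow> 1 / 2"
proof -
  define E where "E = (\<lambda>n. {\<omega> \<in> space M.
    erm_index I (labelled_sample (map (\<lambda>i. X n i \<omega>) [0..<m n])) \<noteq> 2})"
  have E: "\<forall>\<^sub>F n in sequentially. E n \<in> events \<and> prob (E n) \<le> 1 / real n ^ 2"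
    unfolding E_def by (rule eventually_prob_erm_index_neq_2) (fact assms)+
  have L_eq: "L n \<omega> = gen_error (pmf_of_set {2..n}) (hyp 2)" if "\<omega> \<in> space M - E n" for n \<omega>
    using that by (simp add: L erm_hyp_def E_def)
  have lim: "(\<lambda>n. gen_error (pmf_of_set {2..n}) (hyp 2)) \<longlonglongrightarrow> 1 / 2"
    using gen_error_hyp_tendsto[of 2] by simp

  show "tendsto_in_prob M L (1 / 2)"
    unfolding tendsto_in_prob_def
  proof (intro allI impI)
    fix \<epsilon> :: real assume "\<epsilon> > 0"
    then have "\<forall>\<^sub>F n in sequentially. \<bar>gen_error (pmf_of_set {2..n}) (hyp 2) - 1 / 2\<bar> < \<epsilon>"
      using tendstoD[OF lim] by (simp add: dist_real_def)
    with E have "\<forall>\<^sub>F n in sequentially.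
        prob {\<omega> \<in> space M. \<bar>L n \<omega> - 1 / 2\<bar> > \<epsilon>} \<le> 1 / real n ^ 2"
    proof eventually_elim
      case (elim n)
      have "{\<omega> \<in> space M. \<bar>L n \<omega> - 1 / 2\<bar> > \<epsilon>} \<subseteq> E n"
      proof safe
        fix \<omega> assume "\<omega> \<in> space M" "\<bar>L n \<omega> - 1 / 2\<bar> > \<epsilon>"
        then show "\<omega> \<in> E n"
          using elim(2) L_eq[of \<omega> n] by (cases "\<omega> \<in> E n") auto
      qed
      then show ?case
        using elim(1) finite_measure_mono order_trans by blast
    qed
    then show "(\<lambda>n. prob {\<omega> \<in> space M. \<bar>L n \<omega> - 1 / 2\<bar> > \<epsilon>}) \<longlonglongrightarrow> 0"
      by (rule tendsto_sandwich[where f = "\<lambda>_. 0", rotated]) (auto, real_asymp)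
  qed

  \<comment> \<open>The Borel-Cantelli lemma asks for measurability of all events, hence the shift by \<open>N\<close>.\<close>
  obtain N where N: "\<And>n. n \<ge> N \<Longrightarrow> E n \<in> events \<and> prob (E n) \<le> 1 / real n ^ 2"
    using E by (auto simp: eventually_sequentially)
  have "summable (\<lambda>n. prob (E (n + N)))"
  proof (rule summable_comparison_test'[where N = 0])
    show "summable (\<lambda>n. 1 / real (n + N) ^ 2)"
      using inverse_power_summable[of 2, where ?'a = real]
      by (subst summable_iff_shift) (simp add: inverse_eq_divide)
    show "norm (prob (E (n + N))) \<le> 1 / real (n + N) ^ 2" for n
      using N[of "n + N"] by simp
  qed
  then have "AE \<omega> in M. \<forall>\<^sub>F n in sequentially. \<omega> \<in> space M - E (n + N)"
    using N by (intro borel_cantelli_AE1) (auto simp: emeasure_eq_measure)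
  then show "AE \<omega> in M. (\<lambda>n. L n \<omega>) \<longlonglongrightarrow> 1 / 2"
  proof eventually_elim
    case (elim \<omega>)
    then have "\<forall>\<^sub>F n in sequentially. gen_error (pmf_of_set {2..n}) (hyp 2) = L n \<omega>"
      unfolding eventually_sequentially_seg[of "\<lambda>n. \<omega> \<in> space M - E n"]
      by eventually_elim (simp add: L_eq)
    with lim show ?case
      by (rule Lim_transform_eventually)
  qed
qed

theorem proposition2p1:
  fixes M :: "'a measure"
    and I :: "nat set"
    and m :: "nat \<Rightarrow> nat"
    and X :: "nat \<Rightarrow> nat \<Rightarrow> 'a \<Rightarrow> nat"
    and L :: "nat \<Rightarrow> 'a \<Rightarrow> real"
  assumes "prob_space M"
    and "I = instance_space \<or> I = prime_indices"
    and "\<And>n. 2 \<le> n \<Longrightarrow> 0 < m n"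
    and "\<And>n. 2 \<le> n \<Longrightarrow>
           prob_space.indep_vars M (\<lambda>_. count_space UNIV) (X n) {..<m n}"
    and "\<And>n i. 2 \<le> n \<Longrightarrow> i < m n \<Longrightarrow>
           distr M (count_space UNIV) (X n i) = measure_pmf (pmf_of_set {2..n})"
    and L_def: "\<And>n \<omega>. L n \<omega> =
           gen_error (pmf_of_set {2..n})
             (erm_hyp I (labelled_sample (map (\<lambda>i. X n i \<omega>) [0..<m n])))"
  shows "((\<lambda>n. real (m n)) \<in> \<omega>(\<lambda>n. (ln (real n))\<^sup>2) \<longrightarrow> tendsto_in_prob M L (1 / 2)) \<and>
         ((\<lambda>n. real (m n)) \<in> \<omega>(\<lambda>n. (ln (real n)) ^ 3) \<longrightarrow>
            (AE \<omega> in M. (\<lambda>n. L n \<omega>) \<longlonglongrightarrow> 1 / 2))"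
proof -
  interpret prob_space M by fact
  have I: "I \<subseteq> {2..}" "2 \<in> I"
    using assms(2) by (auto simp: instance_space_def prime_indices_def)
  note conv = erm_error_tendsto[of I m X L, OF I assms(3-5) _ L_def]
  have "(\<lambda>n. (ln (real n))\<^sup>2) \<in> \<omega>(\<lambda>n. ln (real n))" "(\<lambda>n. ln (real n) ^ 3) \<in> \<omega>(\<lambda>n. ln (real n))"
    by real_asymp+
  then show ?thesis
    using conv by (blast intro: landau_omega.small_trans)
qed

end
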